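(* The Conditional-Strengthen rule preserves validity of annotated sequents. Precisely: let $A,B$ be conjunctions of $\mathcal{LA}(\mathbb{Z})$ equalities and inequalities and suppose $(A,B)\vdash(\sum_i c_ix_i+c\le 0)\,[\{\langle t'\le 0,\top\rangle\}]$ is a valid annotated sequent. Let $d>0$ be an integer dividing all the $c_i$, let $k=d\lceil c/d\rceil-c$, and let $P$ be the inequality $(\sum_i c_ix_i+c-t'\le 0)$, so that $\neg P$ is (over the integers) the inequality $(-\sum_ic_ix_i-c+t'+1\le 0)$. Assume that every variable of $\sum_i c_ix_i+c+k$ and every variable of $P$ occurs in both $A$ and $B$. Then $(A,B)\vdash(\sum_i c_ix_i+c+k\le 0)\,[I]$ with $I=\{\langle \neg P,\neg P\rangle,\ \langle \sum_ic_ix_i+c+k\le 0,\top\rangle\}$ is a valid annotated sequent (where in the first pair the second component is the inequality $\neg P$ rather than a conjunction of (modular) equalities).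
   Context: $\mathcal{LA}(\mathbb{Z})$: variables range over $\mathbb{Z}$, terms are integer linear combinations of variables plus an integer constant, $\models$ is entailment over integer assignments. $\phi\preceq\psi$ means every variable of $\phi$ occurs in $\psi$. An annotated sequent $(A,B)\vdash(t\le0)[I]$ consists of conjunctions $A,B$ of equalities/inequalities, a linear term $t$, and a set $I$ of pairs $\langle t_i\le0,E_i\rangle$ where $t_i$ is a linear term and $E_i$ is a (possibly empty, i.e. $\top$) conjunction of $\mathcal{LA}(\mathbb{Z})$ constraints (equalities, modular equalities, or — as allowed here — inequalities). It is valid when: (1) $A\models\bigvee_{\langle t_i\le0,E_i\rangle\in I}((t_i\le0)\wedge E_i)$; (2) for all pairs, $B\wedge E_i\models(t-t_i\le0)$; (3) for all pairs, $t_i\preceq A$, $(t-t_i)\preceq B$, $E_i\preceq A$, $E_i\preceq B$. A pair whose first component is $\neg P$ is read with $\neg P$ written as the inequality $(-\sum_ic_ix_i-c+t'+1\le 0)$. *)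

theory Defs
  imports Complex_Main "HOL-Library.Poly_Mapping" "HOL-Library.Product_Plus"
begin

text \<open>A linear term is a finitely supported coefficient function together with an integer
constant. Terms are thus in normal form: \<open>+\<close> and \<open>-\<close> are the componentwise group operations, and
a variable whose coefficients cancel does not occur in the result.\<close>

type_synonym 'v lterm = "('v \<Rightarrow>\<^sub>0 int) \<times> int"

definition const_term :: "int \<Rightarrow> 'v lterm" where
  "const_term c = (0, c)"

definition tvars :: "'v lterm \<Rightarrow> 'v set" where
  "tvars t = Poly_Mapping.keys (fst t)"

definition teval :: "('v \<Rightarrow> int) \<Rightarrow> 'v lterm \<Rightarrow> int" where
  "teval \<sigma> t = (\<Sum>x\<in>Poly_Mapping.keys (fst t). Poly_Mapping.lookup (fst t) x * \<sigma> x) + snd t"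

text \<open>The constraints \<open>t \<le> 0\<close>, \<open>t = 0\<close> and \<open>t = 0 (mod m)\<close>. A conjunction is a list of
constraints; \<open>[]\<close> is the true formula.\<close>

datatype 'v constr =
    Le0 "'v lterm"
  | Eq0 "'v lterm"
  | is_Mod0: Mod0 (modulus: int) "'v lterm"

fun cvars :: "'v constr \<Rightarrow> 'v set" where
  "cvars (Le0 t) = tvars t"
| "cvars (Eq0 t) = tvars t"
| "cvars (Mod0 m t) = tvars t"

fun csat :: "('v \<Rightarrow> int) \<Rightarrow> 'v constr \<Rightarrow> bool" where
  "csat \<sigma> (Le0 t) \<longleftrightarrow> teval \<sigma> t \<le> 0"
| "csat \<sigma> (Eq0 t) \<longleftrightarrow> teval \<sigma> t = 0"
| "csat \<sigma> (Mod0 m t) \<longleftrightarrow> m dvd teval \<sigma> t"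

definition vars :: "'v constr list \<Rightarrow> 'v set" where
  "vars F = (\<Union>C\<in>set F. cvars C)"

definition sat :: "('v \<Rightarrow> int) \<Rightarrow> 'v constr list \<Rightarrow> bool" where
  "sat \<sigma> F \<longleftrightarrow> (\<forall>C\<in>set F. csat \<sigma> C)"

text \<open>In a sequent \<open>(A, B) \<turnstile> (t \<le> 0) [I]\<close> the inequality \<open>t \<le> 0\<close> and the first components
\<open>t\<^sub>i \<le> 0\<close> of the pairs in \<open>I\<close> are represented by the terms \<open>t\<close> and \<open>t\<^sub>i\<close>. The term \<open>t\<close> is
unconstrained, hence is not an argument here.\<close>

definition annotated_sequent ::
  "'v constr list \<Rightarrow> 'v constr list \<Rightarrow> ('v lterm \<times> 'v constr list) set \<Rightarrow> bool" where
  "annotated_sequent A B I \<longleftrightarrow>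
     (\<forall>C\<in>set A \<union> set B. \<not> is_Mod0 C) \<and> finite I \<and>
     (\<forall>(ti, Ei)\<in>I. \<forall>C\<in>set Ei. is_Mod0 C \<longrightarrow> modulus C > 0)"

definition valid_sequent ::
  "'v constr list \<Rightarrow> 'v constr list \<Rightarrow> 'v lterm \<Rightarrow> ('v lterm \<times> 'v constr list) set \<Rightarrow> bool" where
  "valid_sequent A B t I \<longleftrightarrow>
     annotated_sequent A B I \<and>
     (\<forall>\<sigma>. sat \<sigma> A \<longrightarrow> (\<exists>(ti, Ei)\<in>I. csat \<sigma> (Le0 ti) \<and> sat \<sigma> Ei)) \<and>
     (\<forall>(ti, Ei)\<in>I. \<forall>\<sigma>. sat \<sigma> B \<and> sat \<sigma> Ei \<longrightarrow> csat \<sigma> (Le0 (t - ti))) \<and>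
     (\<forall>(ti, Ei)\<in>I. tvars ti \<subseteq> vars A \<and> tvars (t - ti) \<subseteq> vars B \<and>
        vars Ei \<subseteq> vars A \<and> vars Ei \<subseteq> vars B)"

end

theory Submission
  imports Defs
begin

text \<open>The premise says \<open>A \<Turnstile> t' \<le> 0\<close> and \<open>B \<Turnstile> P\<close>. In a model of \<open>A\<close> either \<open>\<not> P\<close> holds, or
\<open>\<Sum>c\<^sub>i x\<^sub>i + c \<le> t' \<le> 0\<close>, and since \<open>d\<close> divides \<open>\<Sum>c\<^sub>i x\<^sub>i\<close> the constant can be rounded up to a
multiple of \<open>d\<close>. The entailment from \<open>B\<close> is vacuous for the pair containing \<open>\<not> P\<close>, as
\<open>B \<Turnstile> P\<close>, and trivial for the other one.\<close>

text \<open>Added indices carry coefficient zero. This lets \<open>s\<close>, \<open>t\<close> and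
  \<open>s + t\<close> be summed over one common index set, although cancellation may shrink the
  keys of \<open>s + t\<close>.\<close>

lemma teval_superset:
  assumes "finite S" "Poly_Mapping.keys (fst t) \<subseteq> S"
  shows "teval \<sigma> t = (\<Sum>x\<in>S. Poly_Mapping.lookup (fst t) x * \<sigma> x) + snd t"
  unfolding teval_def using assms
  by (auto intro!: sum.mono_neutral_left simp: in_keys_iff)

lemma teval_add: "teval \<sigma> (s + t) = teval \<sigma> s + teval \<sigma> t"
proof -
  let ?S = "Poly_Mapping.keys (fst s) \<union> Poly_Mapping.keys (fst t)"
  have "Poly_Mapping.keys (fst (s + t)) \<subseteq> ?S"
    by (simp add: Poly_Mapping.keys_add)
  then show ?thesis
    using teval_superset[of ?S s] teval_superset[of ?S t] teval_superset[of ?S "s + t"]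
    by (simp add: lookup_add sum.distrib algebra_simps)
qed

lemma teval_uminus: "teval \<sigma> (- t) = - teval \<sigma> t"
  by (simp add: teval_def sum_negf)

lemma teval_diff: "teval \<sigma> (s - t) = teval \<sigma> s - teval \<sigma> t"
  using teval_add[of \<sigma> s "- t"] by (simp add: teval_uminus)

lemma teval_const_term: "teval \<sigma> (const_term c) = c"
  by (simp add: teval_def const_term_def)

lemma tvars_diff: "tvars (s - t) \<subseteq> tvars s \<union> tvars t"
  by (simp add: tvars_def keys_diff)

text \<open>Writing \<open>s = d * q\<close> turns the hypothesis into
  \<open>c / d \<le> - q\<close>; the right side is an integer, so it also bounds the
  ceiling.\<close>

lemma add_le_zero_ceiling:
  fixes s c d :: int
  assumes "d > 0" "d dvd s" "s + c \<le> 0"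
  shows "s + d * \<lceil>real_of_int c / real_of_int d\<rceil> \<le> 0"
proof -
  obtain q where q: "s = d * q" using \<open>d dvd s\<close> by blast
  have "c \<le> - q * d"
    using assms(3) by (simp add: q algebra_simps)
  then have "real_of_int c \<le> real_of_int (- q * d)"
    by (simp only: of_int_le_iff)
  then have "\<lceil>real_of_int c / real_of_int d\<rceil> \<le> - q"
    using \<open>d > 0\<close> by (simp add: ceiling_le_iff pos_divide_le_eq)
  then have "d * \<lceil>real_of_int c / real_of_int d\<rceil> \<le> d * - q"
    using \<open>d > 0\<close> by (intro mult_left_mono) auto
  then show ?thesis by (simp add: q)
qed

theorem theorem3p8:
  fixes A B :: "'v constr list"
    and cs :: "'v \<Rightarrow>\<^sub>0 int"
    and c d k :: int
    and t' p np :: "'v lterm"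
  assumes "valid_sequent A B (cs, c) {(t', [])}"
    and "d > 0"
    and "\<forall>x\<in>Poly_Mapping.keys cs. d dvd Poly_Mapping.lookup cs x"
    and "k = d * \<lceil>real_of_int c / real_of_int d\<rceil> - c"
    and P: "p = (cs, c) - t'"
    and not_P: "np = - (cs, c) + t' + const_term 1"
    and "tvars (cs, c + k) \<subseteq> vars A \<and> tvars (cs, c + k) \<subseteq> vars B"
    and "cvars (Le0 p) \<subseteq> vars A \<and> cvars (Le0 p) \<subseteq> vars B"
  shows "valid_sequent A B (cs, c + k) {(np, [Le0 np]), ((cs, c + k), [])}"
proof -
  define linear_part where "linear_part \<sigma> = teval \<sigma> (cs, 0)" for \<sigma>
  have eval_cs: "teval \<sigma> (cs, e) = linear_part \<sigma> + e" for \<sigma> e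
    by (simp add: linear_part_def teval_def)
  have dvd: "d dvd linear_part \<sigma>" for \<sigma>
    using assms(3) by (auto simp: linear_part_def teval_def intro!: dvd_sum)
  have eval_np: "teval \<sigma> np = 1 - linear_part \<sigma> - c + teval \<sigma> t'" for \<sigma>
    unfolding not_P by (simp only: teval_add teval_uminus teval_const_term eval_cs)
  have A: "teval \<sigma> t' \<le> 0" if "sat \<sigma> A" for \<sigma>
    using assms(1) that by (auto simp: valid_sequent_def)
  have B: "linear_part \<sigma> + c \<le> teval \<sigma> t'" if "sat \<sigma> B" for \<sigma>
  proof -
    have "teval \<sigma> ((cs, c) - t') \<le> 0"
      using assms(1) that by (auto simp: valid_sequent_def sat_def)
    then show ?thesis by (simp only: teval_diff eval_cs)
  qed
  \<comment> \<open>If the first disjunct fails, integrality gives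
    \<open>teval \<sigma> np \<ge> 1\<close>, and the 1 in \<open>np\<close> cancels to leave
    \<open>linear_part \<sigma> + c \<le> teval \<sigma> t'\<close>. By the choice of
    \<open>k\<close>, \<open>c + k\<close> is exactly the rounded constant.\<close>
  have "teval \<sigma> np \<le> 0 \<or> teval \<sigma> (cs, c + k) \<le> 0" if "sat \<sigma> A" for \<sigma>
    using add_le_zero_ceiling[OF \<open>d > 0\<close> dvd, of \<sigma> c] A[OF that]
    unfolding eval_np eval_cs assms(4) by linarith
  moreover have "\<not> teval \<sigma> np \<le> 0" if "sat \<sigma> B" for \<sigma>
    using B[OF that] by (simp add: eval_np)
  \<comment> \<open>Negation and the added 1 leave the set of variables unchanged, so the variable
    conditions on \<open>P\<close> carry over to \<open>np\<close>.\<close>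
  moreover have "fst np = - fst p"
    by (simp add: P not_P const_term_def)
  then have tvars_np: "tvars np = tvars p"
    by (simp add: tvars_def)
  moreover have "tvars ((cs, c + k) - np) \<subseteq> vars B"
    using tvars_diff[of "(cs, c + k)" np] tvars_np assms(7,8) by auto
  \<comment> \<open>The second pair repeats the term of the conclusion, so its difference is of the
    form \<open>t - t\<close>.\<close>
  moreover have "tvars (t - t) = {}" "teval \<sigma> (t - t) = 0" for t :: "'v lterm" and \<sigma>
    by (simp_all add: tvars_def teval_def)
  ultimately show ?thesis
    using assms(1,7,8)
    by (auto simp: valid_sequent_def annotated_sequent_def sat_def vars_def)
qed

end
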